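(* For every school choice problem, the match $\mu_2$ produced by the two-stage DA-TTC algorithm (Deferred Acceptance producing $\mu_1$, followed by the restricted Top Trading Cycles stage started at $\mu_1$ and producing $\mu_2$) is in the unified core; that is, $\mu_2$ is neither between-group blocked nor within-group blocked.
   Context: **School choice problem.** There is a finite set $I$ of students and a finite set $S$ of schools (collectively, agents). Each school $s$ has a capacity $q_s\ge 1$. A match is a function $\mu: I\to I\cup S$ with $\mu(i)\in S\cup\{i\}$ for every $i\in I$ and $|\mu^{-1}(s)|\le q_s$ for every $s\in S$ ($\mu(i)=i$ means $i$ is unmatched). Every student $i$ has a strict preference (strict linear order) $\succ_i$ over $S\cup\{i\}$, with associated weak preference $\succsim_i$. Each school $s$ has two priorities over $I$: a between-group priority $\succsim_s$, a weak order (complete, transitive), with strict part $\succ_s$ and indifference part $\sim_s$; and a within-group priority $\succ^*_s$, a strict linear order on $I$ with weak version $\succsim^*_s$. The within-group priority refines the between-group priority: $i\succ_s j$ implies $i\succ^*_s j$. The priority group of $i$ at $s$ is $[i]_s=\{j\in I: j\sim_s i\}$. **Comparing groups of students.** For $A,A'\subseteq I$ with $|A|=|A'|$, write $A\succsim_s A'$ if the students can be indexed $A=\{a_1,\dots,a_n\}$, $A'=\{a'_1,\dots,a'_n\}$ with $a_k\succsim_s a'_k$ for all $k$. Write $A\sim_s A'$ if $A\succsim_s A'$ and $A'\succsim_s A$; sets of different cardinality are never related by $\sim_s$. **Blocking.** A coalition is a subset $A\subseteq I$. $A$ prefers $\nu$ to $\mu$ if $\nu(i)\succsim_i\mu(i)$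 for every $i\in A$, with strict preference for some $i\in A$. *Between-group.* $A$ can between-group enforce match $\nu$ over match $\mu$ if for every $i\in A$ with $\nu(i)=s\in S$, either there is $j\in\mu^{-1}(s)$ with $i\succ_s j$, or $|\mu^{-1}(s)|<q_s$ (no condition is imposed for $i\in A$ with $\nu(i)=i$). $A$ between-group blocks $\mu$ if it can between-group enforce some match $\nu$ over $\mu$ that $A$ prefers to $\mu$. *Within-group.* Let $U_s(i)=\{j\in[i]_s: j\succsim^*_s i\}$. Given $A$ and $\nu$, the within-group interrupters of $i\in A$ with $\nu(i)=s\in S$ are the students in $U_s(i)\setminus A$. $A$ can within-group enforce match $\nu$ over match $\mu$ if for every school $s\in\nu(A)$: (1) $\nu^{-1}(s)\sim_s\mu^{-1}(s)$; and (2) the sum, over all students $i\in A$ with $\nu(i)=s$, of the number of within-group interrupters of $i$ is at most $q_s-|\nu^{-1}(s)|$. $A$ within-group blocks $\mu$ if it can within-group enforce some match $\nu$ over $\mu$ that $A$ prefers to $\mu$. A match is in the unified core if it is neither between-group blocked nor within-group blocked by any coalition. **Stage 1 (Deferred Acceptance), producing $\mu_1$.** Every student $i$ points to (proposes to) her $\succsim_i$-highest agent in $S\cup\{i\}$. While more than $q_s$ students point to some school $s$: $s$ rejects all but the $\succ^*_s$-top $q_s$ students who proposed to $s$; then every student $i$ points to her $\succsim_i$-highest agent in $S\cup\{i\}$ who has not yet rejected her (students never reject themselves). At termination, $\mu_1$ assigns each student to the agent she last proposed to. **Stage 2 (restricted Top Trading Cycles), producing $\mu_2$.** Initialize $\mu_2:=\mu_1$.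 A student $i$ is initially active if $\mu_1(i)\in S$ and $j\succsim_{\mu_1(i)} i$ for every $j\in\mu_1^{-1}(\mu_1(i))$; students with $\mu_1(i)=i$ are inactive. A school $s$ is active whenever there is an active student in $\mu_1^{-1}(s)$. While there is an active student: each active student $i$ points to her $\succ_i$-most preferred active school in $\{s\in S: \text{there is an active } j\in\mu_1^{-1}(s)\text{ with } i\sim_s j\}$; each active school $s$ points to the $\succ^*_s$-highest active student in $\mu_1^{-1}(s)$; a cycle $i_1,s_1,\dots,i_n,s_n$ exists (each $i_k$ points to $s_k$, and $s_k$ points to $i_{k+1}$, indices modulo $n$); for every $k$ set $\mu_2(i_k):=s_k$ and deactivate $i_k$, and deactivate $s_k$ if no active student remains in $\mu_1^{-1}(s_k)$. The process stops when no student is active. *)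

theory Defs
  imports Main
begin

text \<open>
  A match is a partial map from students to schools; the value \<open>None\<close> at student \<open>i\<close> stands for
  being matched to \<open>i\<close> herself. Accordingly, \<open>i\<close>'s preference is over \<open>None\<close> (meaning \<open>i\<close>) and
  \<open>Some s\<close> for schools \<open>s\<close>. Only the values of a match on the set \<open>I\<close> are ever inspected.
  In all relations the better element comes first: \<open>(x, y) \<in> P i\<close> says that \<open>i\<close> strictly
  prefers \<open>x\<close> to \<open>y\<close>, \<open>(i, j) \<in> B s\<close> that \<open>i\<close> has weakly higher between-group priority at \<open>s\<close>
  than \<open>j\<close>, and \<open>(i, j) \<in> W s\<close> that \<open>i\<close> has strictly higher within-group priority than \<open>j\<close>.
\<close>

definition best :: "'a rel \<Rightarrow> 'a set \<Rightarrow> 'a \<Rightarrow> bool" where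
  "best r X x \<longleftrightarrow> x \<in> X \<and> (\<forall>y\<in>X. y \<noteq> x \<longrightarrow> (x, y) \<in> r)"

locale school_choice =
  fixes I :: "'i set"
    and S :: "'s set"
    and q :: "'s \<Rightarrow> nat"
    and P :: "'i \<Rightarrow> 's option rel"
    and B :: "'s \<Rightarrow> 'i rel"
    and W :: "'s \<Rightarrow> 'i rel"
  assumes finite_students: "finite I"
    and finite_schools: "finite S"
    and capacity: "s \<in> S \<Longrightarrow> 1 \<le> q s"
    and preference_carrier: "i \<in> I \<Longrightarrow> P i \<subseteq> insert None (Some ` S) \<times> insert None (Some ` S)"
    and preference_order: "i \<in> I \<Longrightarrow> strict_linear_order_on (insert None (Some ` S)) (P i)"
    and between_preorder: "s \<in> S \<Longrightarrow> preorder_on I (B s)"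
    and between_total: "s \<in> S \<Longrightarrow> total_on I (B s)"
    and within_carrier: "s \<in> S \<Longrightarrow> W s \<subseteq> I \<times> I"
    and within_order: "s \<in> S \<Longrightarrow> strict_linear_order_on I (W s)"
    and within_refines_between:
      "s \<in> S \<Longrightarrow> (i, j) \<in> B s \<Longrightarrow> (j, i) \<notin> B s \<Longrightarrow> (i, j) \<in> W s"
begin

definition assigned :: "('i \<rightharpoonup> 's) \<Rightarrow> 's \<Rightarrow> 'i set" where
  "assigned \<mu> s = {i \<in> I. \<mu> i = Some s}"

definition is_match :: "('i \<rightharpoonup> 's) \<Rightarrow> bool" where
  "is_match \<mu> \<longleftrightarrow>
     (\<forall>i\<in>I. \<mu> i \<in> insert None (Some ` S)) \<and> (\<forall>s\<in>S. card (assigned \<mu> s) \<le> q s)"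

definition strictly_above :: "'s \<Rightarrow> 'i \<Rightarrow> 'i \<Rightarrow> bool" where
  "strictly_above s i j \<longleftrightarrow> (i, j) \<in> B s \<and> (j, i) \<notin> B s"

definition indifferent :: "'s \<Rightarrow> 'i \<Rightarrow> 'i \<Rightarrow> bool" where
  "indifferent s i j \<longleftrightarrow> (i, j) \<in> B s \<and> (j, i) \<in> B s"

definition priority_group :: "'s \<Rightarrow> 'i \<Rightarrow> 'i set" where
  "priority_group s i = {j \<in> I. indifferent s j i}"

text \<open>The bijection pairs the members of the two sets with equal index.\<close>

definition set_weakly_above :: "'s \<Rightarrow> 'i set \<Rightarrow> 'i set \<Rightarrow> bool" where
  "set_weakly_above s A A' \<longleftrightarrow> (\<exists>f. bij_betw f A A' \<and> (\<forall>a\<in>A. (a, f a) \<in> B s))"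

definition set_indifferent :: "'s \<Rightarrow> 'i set \<Rightarrow> 'i set \<Rightarrow> bool" where
  "set_indifferent s A A' \<longleftrightarrow> set_weakly_above s A A' \<and> set_weakly_above s A' A"

definition coalition_prefers :: "'i set \<Rightarrow> ('i \<rightharpoonup> 's) \<Rightarrow> ('i \<rightharpoonup> 's) \<Rightarrow> bool" where
  "coalition_prefers A \<nu> \<mu> \<longleftrightarrow>
     (\<forall>i\<in>A. (\<nu> i, \<mu> i) \<in> (P i)\<^sup>=) \<and> (\<exists>i\<in>A. (\<nu> i, \<mu> i) \<in> P i)"

definition between_enforces :: "'i set \<Rightarrow> ('i \<rightharpoonup> 's) \<Rightarrow> ('i \<rightharpoonup> 's) \<Rightarrow> bool" where
  "between_enforces A \<nu> \<mu> \<longleftrightarrow>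
     (\<forall>i\<in>A. \<forall>s\<in>S. \<nu> i = Some s \<longrightarrow>
        (\<exists>j\<in>assigned \<mu> s. strictly_above s i j) \<or> card (assigned \<mu> s) < q s)"

definition between_blocks :: "'i set \<Rightarrow> ('i \<rightharpoonup> 's) \<Rightarrow> bool" where
  "between_blocks A \<mu> \<longleftrightarrow>
     (\<exists>\<nu>. is_match \<nu> \<and> between_enforces A \<nu> \<mu> \<and> coalition_prefers A \<nu> \<mu>)"

definition upper_group :: "'s \<Rightarrow> 'i \<Rightarrow> 'i set" where
  "upper_group s i = {j \<in> priority_group s i. (j, i) \<in> (W s)\<^sup>=}"

definition interrupters :: "'i set \<Rightarrow> 's \<Rightarrow> 'i \<Rightarrow> 'i set" where
  "interrupters A s i = upper_group s i - A"

definition within_enforces :: "'i set \<Rightarrow> ('i \<rightharpoonup> 's) \<Rightarrow> ('i \<rightharpoonup> 's) \<Rightarrow> bool" where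
  "within_enforces A \<nu> \<mu> \<longleftrightarrow>
     (\<forall>s\<in>S. Some s \<in> \<nu> ` A \<longrightarrow>
        set_indifferent s (assigned \<nu> s) (assigned \<mu> s) \<and>
        (\<Sum>i\<in>{i \<in> A. \<nu> i = Some s}. card (interrupters A s i)) \<le> q s - card (assigned \<nu> s))"

definition within_blocks :: "'i set \<Rightarrow> ('i \<rightharpoonup> 's) \<Rightarrow> bool" where
  "within_blocks A \<mu> \<longleftrightarrow>
     (\<exists>\<nu>. is_match \<nu> \<and> within_enforces A \<nu> \<mu> \<and> coalition_prefers A \<nu> \<mu>)"

definition unified_core :: "('i \<rightharpoonup> 's) set" where
  "unified_core =
     {\<mu>. is_match \<mu> \<and> \<not> (\<exists>A\<subseteq>I. between_blocks A \<mu>) \<and> \<not> (\<exists>A\<subseteq>I. within_blocks A \<mu>)}"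

text \<open>
  Deferred Acceptance. The state is the set \<open>R\<close> of rejections made so far, where \<open>(s, i) \<in> R\<close>
  means that \<open>s\<close> has rejected \<open>i\<close>. If several schools are over-demanded, any one of them may be
  processed next.
\<close>

definition da_points :: "('s \<times> 'i) set \<Rightarrow> 'i \<Rightarrow> 's option \<Rightarrow> bool" where
  "da_points R i a \<longleftrightarrow> best (P i) (insert None (Some ` {s \<in> S. (s, i) \<notin> R})) a"

definition proposers :: "('s \<times> 'i) set \<Rightarrow> 's \<Rightarrow> 'i set" where
  "proposers R s = {i \<in> I. da_points R i (Some s)}"

definition top_proposers :: "('s \<times> 'i) set \<Rightarrow> 's \<Rightarrow> 'i set" where
  "top_proposers R s = {i \<in> proposers R s. card {j \<in> proposers R s. (j, i) \<in> W s} < q s}"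

definition da_step :: "('s \<times> 'i) set \<Rightarrow> ('s \<times> 'i) set \<Rightarrow> bool" where
  "da_step R R' \<longleftrightarrow>
     (\<exists>s\<in>S. q s < card (proposers R s) \<and>
            R' = R \<union> {s} \<times> (proposers R s - top_proposers R s))"

definition da_result :: "('i \<rightharpoonup> 's) \<Rightarrow> bool" where
  "da_result \<mu>1 \<longleftrightarrow>
     (\<exists>R. da_step\<^sup>*\<^sup>* {} R \<and> (\<forall>s\<in>S. card (proposers R s) \<le> q s) \<and>
          (\<forall>i\<in>I. da_points R i (\<mu>1 i)))"

text \<open>
  Restricted Top Trading Cycles. The state consists of the set \<open>A\<close> of active students and the
  current match. The active schools are determined by \<open>A\<close>. If several cycles exist, any one of
  them may be executed next.
\<close>

definition initially_active :: "('i \<rightharpoonup> 's) \<Rightarrow> 'i set" where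
  "initially_active \<mu>1 =
     {i \<in> I. \<exists>s\<in>S. \<mu>1 i = Some s \<and> (\<forall>j\<in>assigned \<mu>1 s. (j, i) \<in> B s)}"

definition active_schools :: "('i \<rightharpoonup> 's) \<Rightarrow> 'i set \<Rightarrow> 's set" where
  "active_schools \<mu>1 A = {s \<in> S. assigned \<mu>1 s \<inter> A \<noteq> {}}"

definition student_points :: "('i \<rightharpoonup> 's) \<Rightarrow> 'i set \<Rightarrow> 'i \<Rightarrow> 's \<Rightarrow> bool" where
  "student_points \<mu>1 A i s \<longleftrightarrow>
     best (P i)
       (Some ` {t \<in> active_schools \<mu>1 A. \<exists>j\<in>assigned \<mu>1 t \<inter> A. indifferent t i j}) (Some s)"

definition school_points :: "('i \<rightharpoonup> 's) \<Rightarrow> 'i set \<Rightarrow> 's \<Rightarrow> 'i \<Rightarrow> bool" where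
  "school_points \<mu>1 A s i \<longleftrightarrow> best (W s) (assigned \<mu>1 s \<inter> A) i"

definition ttc_cycle :: "('i \<rightharpoonup> 's) \<Rightarrow> 'i set \<Rightarrow> 'i list \<Rightarrow> 's list \<Rightarrow> bool" where
  "ttc_cycle \<mu>1 A js ss \<longleftrightarrow>
     js \<noteq> [] \<and> length ss = length js \<and> distinct js \<and> distinct ss \<and>
     set js \<subseteq> A \<and> set ss \<subseteq> active_schools \<mu>1 A \<and>
     (\<forall>k<length js. student_points \<mu>1 A (js ! k) (ss ! k) \<and>
        school_points \<mu>1 A (ss ! k) (js ! (Suc k mod length js)))"

definition ttc_step ::
    "('i \<rightharpoonup> 's) \<Rightarrow> 'i set \<times> ('i \<rightharpoonup> 's) \<Rightarrow> 'i set \<times> ('i \<rightharpoonup> 's) \<Rightarrow> bool" where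
  "ttc_step \<mu>1 = (\<lambda>(A, \<mu>) (A', \<mu>').
     \<exists>js ss. ttc_cycle \<mu>1 A js ss \<and> A' = A - set js \<and> \<mu>' = \<mu>(js [\<mapsto>] ss))"

definition ttc_result :: "('i \<rightharpoonup> 's) \<Rightarrow> ('i \<rightharpoonup> 's) \<Rightarrow> bool" where
  "ttc_result \<mu>1 \<mu>2 \<longleftrightarrow> (ttc_step \<mu>1)\<^sup>*\<^sup>* (initially_active \<mu>1, \<mu>1) ({}, \<mu>2)"

definition da_ttc_result :: "('i \<rightharpoonup> 's) \<Rightarrow> bool" where
  "da_ttc_result \<mu>2 \<longleftrightarrow> (\<exists>\<mu>1. da_result \<mu>1 \<and> ttc_result \<mu>1 \<mu>2)"

end

end

theory Submission
  imports Defs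
begin

text \<open>
  The match \<open>\<mu>1\<close> is stable: a school that a student \<open>i\<close> prefers to \<open>\<mu>1 i\<close> is full with students
  above \<open>i\<close>. Trading makes no student worse off and, at every school, exchanges
  students of the bottom between-group class for students of the same class; hence a
  between-group block of \<open>\<mu>2\<close> would contradict the stability of \<open>\<mu>1\<close>.

  Suppose that a coalition within-group blocks \<open>\<mu>2\<close> by \<open>\<nu>\<close>. A school \<open>s\<close> which some member obtains
  in \<open>\<nu>\<close> and prefers to her \<open>\<mu>1\<close>-school is full, so the coalition has no interrupters at \<open>s\<close>. As
  the bottom class of \<open>s\<close> at \<open>\<mu>1\<close> is tied with the new member and has higher within-group
  priority, it lies in the coalition. By induction over the trading cycles, every student who
  obtains such a school by trading obtains it in \<open>\<nu>\<close> as well. Since the two matches fill equally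
  many places of \<open>s\<close> with students of the bottom class, nobody in the coalition is strictly
  better off in \<open>\<nu>\<close> than in \<open>\<mu>2\<close>.
\<close>

section \<open>Finite linear orders, cyclic lists and orbits of self-maps\<close>

lemma best_exists:
  assumes "finite X" "X \<noteq> {}" "X \<subseteq> C" "strict_linear_order_on C r"
  shows "\<exists>x. best r X x"
  using assms(1-3)
proof (induction rule: finite_ne_induct)
  case (singleton x)
  then show ?case by (auto simp: best_def)
next
  case (insert x X)
  then obtain y where y: "best r X y" by auto
  have tr: "trans r" and tot: "total_on C r"
    using assms(4) by (auto simp: strict_linear_order_on_def)
  have "x \<noteq> y" using y insert by (auto simp: best_def)
  then consider "(x, y) \<in> r" | "(y, x) \<in> r"
    using tot y insert by (auto simp: best_def total_on_def)
  then show ?case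
  proof cases
    case 1
    then have "best r (insert x X) x"
      using y tr unfolding best_def by (metis insert_iff transD)
    then show ?thesis ..
  next
    case 2
    then have "best r (insert x X) y" using y unfolding best_def by auto
    then show ?thesis ..
  qed
qed

lemma best_unique:
  assumes "best r X x" "best r X y" "X \<subseteq> C" "strict_linear_order_on C r"
  shows "x = y"
  using assms unfolding best_def strict_linear_order_on_def
  by (metis irrefl_def transD)

lemma best_weakly_above: "best r X x \<Longrightarrow> y \<in> X \<Longrightarrow> (x, y) \<in> r\<^sup>="
  by (auto simp: best_def)

text \<open>Counting the elements above \<open>x\<close> gives its rank. Ranks grow strictly along
  \<open>r\<close>, so on \<open>X\<close> they are injective with values below
  \<open>card X\<close>; hence they fill \<open>{..<card X}\<close>, and
  \<open>min n (card X)\<close> of them lie below \<open>n\<close>.\<close>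

lemma card_top_elements:
  assumes "finite X" "X \<subseteq> C" "strict_linear_order_on C r"
  shows "card {x \<in> X. card {y \<in> X. (y, x) \<in> r} < n} = min n (card X)"
proof -
  let ?rk = "\<lambda>x. card {y \<in> X. (y, x) \<in> r}"
  have tr: "trans r" and irr: "irrefl r" and tot: "total_on C r"
    using assms(3) by (auto simp: strict_linear_order_on_def)
  have less: "?rk x < ?rk y" if "x \<in> X" "y \<in> X" "(x, y) \<in> r" for x y
  proof (rule psubset_card_mono)
    show "{z \<in> X. (z, x) \<in> r} \<subset> {z \<in> X. (z, y) \<in> r}"
      using that tr irr by (auto simp: irrefl_def dest: transD)
  qed (use assms in auto)
  have inj: "inj_on ?rk X"
  proof (rule inj_onI, rule ccontr)
    fix x y assume xy: "x \<in> X" "y \<in> X" "?rk x = ?rk y" "x \<noteq> y"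
    then have "(x, y) \<in> r \<or> (y, x) \<in> r"
      using tot assms(2) by (auto simp: total_on_def)
    then show False using less xy by fastforce
  qed
  have "?rk ` X \<subseteq> {..<card X}"
  proof
    fix m assume "m \<in> ?rk ` X"
    then obtain x where x: "x \<in> X" "m = ?rk x" by auto
    have "{y \<in> X. (y, x) \<in> r} \<subset> X" using x irr by (auto simp: irrefl_def)
    then show "m \<in> {..<card X}" using x assms psubset_card_mono by auto
  qed
  then have img: "?rk ` X = {..<card X}"
    using inj by (simp add: card_image card_subset_eq)
  have "?rk ` {x \<in> X. ?rk x < n} = ?rk ` X \<inter> {..<n}" by auto
  then have "?rk ` {x \<in> X. ?rk x < n} = {..<min n (card X)}" unfolding img by auto
  then have "card (?rk ` {x \<in> X. ?rk x < n}) = min n (card X)" by simp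
  moreover have "inj_on ?rk {x \<in> X. ?rk x < n}" using inj by (rule inj_on_subset) auto
  ultimately show ?thesis by (simp add: card_image)
qed

text \<open>Serves the termination of both stages: \<open>Q\<close> is an invariant,
  \<open>f\<close> a measure and \<open>N\<close> the stopping condition. The steps are
  nondeterministic, so only the existence of a decreasing step is asked for.\<close>

lemma terminating_relation_reaches_normal_form:
  fixes f :: "'a \<Rightarrow> nat"
  assumes "Q x"
    and step: "\<And>x. Q x \<Longrightarrow> \<not> N x \<Longrightarrow> \<exists>y. r x y \<and> Q y \<and> f y < f x"
  shows "\<exists>y. r\<^sup>*\<^sup>* x y \<and> Q y \<and> N y"
  using assms(1)
proof (induction "f x" arbitrary: x rule: less_induct)
  case less
  show ?case
  proof (cases "N x")
    case True
    then show ?thesis using less.prems by auto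
  next
    case False
    then obtain y where y: "r x y" "Q y" "f y < f x" using step less.prems by blast
    then show ?thesis using less.hyps by (meson converse_rtranclp_into_rtranclp)
  qed
qed

text \<open>Moves counting from sets to lists, where rotating a trading cycle changes no
  count.\<close>

lemma card_preimage_distinct_list:
  assumes "distinct xs"
  shows "card {x \<in> set xs. f x = y} = count_list (map f xs) y"
  using assms
proof (induction xs)
  case (Cons x xs)
  have "{z \<in> set (x # xs). f z = y} =
      (if f x = y then insert x {z \<in> set xs. f z = y} else {z \<in> set xs. f z = y})"
    by auto
  then show ?case using Cons by auto
qed simp

lemma nth_rotate1: "k < length xs \<Longrightarrow> rotate1 xs ! k = xs ! (Suc k mod length xs)"
  using nth_rotate[of k xs 1] by simp

lemma map_upds_nth:
  "distinct xs \<Longrightarrow> length ys = length xs \<Longrightarrow> k < length xs \<Longrightarrow>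
    (m(xs [\<mapsto>] ys)) (xs ! k) = Some (ys ! k)"
proof (induction xs arbitrary: m ys k)
  case (Cons x xs)
  then obtain y zs where "ys = y # zs" by (cases ys) auto
  then show ?case using Cons by (cases k) auto
qed simp

text \<open>From \<open>j\<close>, the index \<open>k\<close> is reached after
  \<open>n - j + k\<close> steps around the cycle.\<close>

lemma cyclic_invariant:
  assumes step: "\<And>k. k < n \<Longrightarrow> Q k \<Longrightarrow> Q (Suc k mod n)"
    and "j < n" "Q j" "k < n"
  shows "Q (k :: nat)"
proof -
  have *: "Q ((j + m) mod n)" for m
  proof (induction m)
    case 0
    then show ?case using assms by simp
  next
    case (Suc m)
    have "Suc ((j + m) mod n) mod n = (j + Suc m) mod n" by (simp add: mod_Suc_eq)
    then show ?case using step[OF _ Suc] assms(2) by simp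
  qed
  have "(j + (n - j + k)) mod n = k" using assms by simp
  then show ?thesis using *[of "n - j + k"] by simp
qed

text \<open>An injective orbit would be infinite inside \<open>A\<close>, so some point
  \<open>b\<close> is periodic; its orbit over one least period is the cycle.\<close>

lemma finite_orbit_cycle:
  fixes g :: "'a \<Rightarrow> 'a"
  assumes "finite A" "a \<in> A" "g ` A \<subseteq> A"
  obtains xs where "xs \<noteq> []" "distinct xs" "set xs \<subseteq> A"
    "\<And>k. k < length xs \<Longrightarrow> g (xs ! k) = xs ! (Suc k mod length xs)"
proof -
  have inA: "(g ^^ n) x \<in> A" if "x \<in> A" for n x
    using that assms(3) by (induction n) auto
  have "\<not> inj (\<lambda>n. (g ^^ n) a)"
  proof
    assume "inj (\<lambda>n. (g ^^ n) a)"
    then have "infinite (range (\<lambda>n. (g ^^ n) a))" by (simp add: finite_image_iff)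
    moreover have "range (\<lambda>n. (g ^^ n) a) \<subseteq> A" using inA assms(2) by auto
    ultimately show False using assms(1) finite_subset by blast
  qed
  then obtain m n where mn: "m < n" "(g ^^ m) a = (g ^^ n) a"
    unfolding inj_def by (metis linorder_neqE_nat)
  define b where "b = (g ^^ m) a"
  have bA: "b \<in> A" using inA assms(2) by (simp add: b_def)
  have "(g ^^ (n - m)) b = (g ^^ (n - m + m)) a"
    unfolding b_def by (simp only: funpow_add o_apply)
  then have "n - m > 0 \<and> (g ^^ (n - m)) b = b" using mn by (simp add: b_def)
  then obtain p where p: "p > 0" "(g ^^ p) b = b"
    and min: "\<And>k. k > 0 \<Longrightarrow> (g ^^ k) b = b \<Longrightarrow> p \<le> k"
    using exists_least_iff[of "\<lambda>p. p > 0 \<and> (g ^^ p) b = b"] by (metis leI)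
  define xs where "xs = map (\<lambda>k. (g ^^ k) b) [0..<p]"
  have neq: "(g ^^ k) b \<noteq> (g ^^ l) b" if "k < l" "l < p" for k l
  proof
    assume "(g ^^ k) b = (g ^^ l) b"
    \<comment> \<open>Another \<open>p - l\<close> applications complete the period on the right and
      give \<open>b\<close> the shorter period \<open>p - l + k\<close>.\<close>
    then have "(g ^^ (p - l)) ((g ^^ k) b) = (g ^^ (p - l)) ((g ^^ l) b)" by simp
    then have "(g ^^ (p - l + k)) b = (g ^^ (p - l + l)) b"
      by (simp only: funpow_add o_apply)
    then have "(g ^^ (p - l + k)) b = b" using p that by simp
    then show False using min[of "p - l + k"] that by linarith
  qed
  have "inj_on (\<lambda>k. (g ^^ k) b) {0..<p}"
    by (rule inj_onI) (metis neq atLeastLessThan_iff linorder_neqE_nat)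
  then have "distinct xs" by (simp add: xs_def distinct_map)
  moreover have "xs \<noteq> []" using p by (simp add: xs_def)
  moreover have "set xs \<subseteq> A" using inA bA by (auto simp: xs_def)
  moreover have "g (xs ! k) = xs ! (Suc k mod length xs)" if "k < length xs" for k
  proof (cases "Suc k = p")
    case True
    then have "g ((g ^^ k) b) = b" using p by auto
    then show ?thesis using True that by (simp add: xs_def)
  next
    case False
    then show ?thesis using that by (simp add: xs_def)
  qed
  ultimately show thesis using that by blast
qed

section \<open>Elementary order facts for preferences and priorities\<close>

context school_choice
begin

lemma preference_trans:
  "i \<in> I \<Longrightarrow> (x, y) \<in> P i \<Longrightarrow> (y, z) \<in> P i \<Longrightarrow> (x, z) \<in> P i"
  using preference_order by (auto simp: strict_linear_order_on_def dest: transD)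

lemma preference_irrefl: "i \<in> I \<Longrightarrow> (x, x) \<notin> P i"
  using preference_order by (auto simp: strict_linear_order_on_def irrefl_def)

lemma within_irrefl: "s \<in> S \<Longrightarrow> (i, i) \<notin> W s"
  using within_order by (auto simp: strict_linear_order_on_def irrefl_def)

lemma within_trans:
  "s \<in> S \<Longrightarrow> (i, j) \<in> W s \<Longrightarrow> (j, k) \<in> W s \<Longrightarrow> (i, k) \<in> W s"
  using within_order by (auto simp: strict_linear_order_on_def dest: transD)

lemma within_total:
  "s \<in> S \<Longrightarrow> i \<in> I \<Longrightarrow> j \<in> I \<Longrightarrow> i \<noteq> j \<Longrightarrow> (i, j) \<in> W s \<or> (j, i) \<in> W s"
  using within_order by (auto simp: strict_linear_order_on_def total_on_def)

lemma between_trans: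
  "s \<in> S \<Longrightarrow> (i, j) \<in> B s \<Longrightarrow> (j, k) \<in> B s \<Longrightarrow> (i, k) \<in> B s"
  using between_preorder by (auto simp: preorder_on_def dest: transD)

lemma between_refl: "s \<in> S \<Longrightarrow> i \<in> I \<Longrightarrow> (i, i) \<in> B s"
  using between_preorder by (auto simp: preorder_on_def refl_on_def)

lemma between_total':
  "s \<in> S \<Longrightarrow> i \<in> I \<Longrightarrow> j \<in> I \<Longrightarrow> (i, j) \<in> B s \<or> (j, i) \<in> B s"
  using between_total between_refl by (fastforce simp: total_on_def)

text \<open>By totality the only alternative is that \<open>j\<close> is strictly above
  \<open>i\<close> between groups; refinement would then reverse the given within-group
  comparison.\<close>

lemma within_imp_between:
  assumes "s \<in> S" "(i, j) \<in> W s"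
  shows "(i, j) \<in> B s"
proof (rule ccontr)
  assume n: "(i, j) \<notin> B s"
  have "i \<in> I" "j \<in> I" using assms within_carrier by auto
  then have "(j, i) \<in> B s" using between_total' n assms by auto
  then have "(j, i) \<in> W s" using within_refines_between n assms by auto
  then show False using within_trans within_irrefl assms by blast
qed

lemma assigned_subset: "assigned \<mu> s \<subseteq> I"
  by (auto simp: assigned_def)

lemma finite_assigned [simp]: "finite (assigned \<mu> s)"
  using assigned_subset finite_students by (rule finite_subset)

subsection \<open>Deferred Acceptance\<close>

lemma da_points_unique: "i \<in> I \<Longrightarrow> da_points R i a \<Longrightarrow> da_points R i b \<Longrightarrow> a = b"
  unfolding da_points_def
  by (erule (1) best_unique[OF _ _ _ preference_order]) auto

lemma da_points_exists: "i \<in> I \<Longrightarrow> \<exists>a. da_points R i a"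
  unfolding da_points_def
  by (rule best_exists[OF _ _ _ preference_order]) (auto simp: finite_schools)

lemma proposers_subset: "proposers R s \<subseteq> I"
  by (auto simp: proposers_def)

lemma finite_proposers [simp]: "finite (proposers R s)"
  using proposers_subset finite_students by (rule finite_subset)

lemma card_top_proposers:
  "s \<in> S \<Longrightarrow> card (top_proposers R s) = min (q s) (card (proposers R s))"
  unfolding top_proposers_def
  by (rule card_top_elements[OF _ proposers_subset within_order]) auto

text \<open>A best option stays best while the menu shrinks around it.\<close>

lemma proposers_persist:
  assumes "i \<in> proposers R s" "R \<subseteq> R'" "(s, i) \<notin> R'"
  shows "i \<in> proposers R' s"
  using assms unfolding proposers_def da_points_def best_def by auto

text \<open>Invariant of Deferred Acceptance. The proposers are counted in the current state and not
  at the time of the rejection, so that at termination the bound concerns the students assigned to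
  the school.\<close>

definition rejections_justified :: "('s \<times> 'i) set \<Rightarrow> bool" where
  "rejections_justified R \<longleftrightarrow> R \<subseteq> S \<times> I \<and>
     (\<forall>(s, i)\<in>R. q s \<le> card {j \<in> proposers R s. (j, i) \<in> W s})"

text \<open>Other schools lose no proposer. At \<open>s\<close> the \<open>q s\<close> top proposers
  are kept, and they outrank every student whom \<open>s\<close> rejects now or has rejected
  earlier.\<close>

lemma da_step_rejections_justified:
  assumes "da_step R R'" "rejections_justified R"
  shows "rejections_justified R'"
proof -
  from assms(1) obtain s where s: "s \<in> S" "q s < card (proposers R s)"
    and R': "R' = R \<union> {s} \<times> (proposers R s - top_proposers R s)"
    unfolding da_step_def by auto
  have "q t \<le> card {j \<in> proposers R' t. (j, i) \<in> W t}" if ti: "(t, i) \<in> R'" for t i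
  proof (cases "t = s")
    case False
    then have "(t, i) \<in> R" using ti R' by auto
    then have "q t \<le> card {j \<in> proposers R t. (j, i) \<in> W t}"
      using assms(2) by (auto simp: rejections_justified_def)
    also have "\<dots> \<le> card {j \<in> proposers R' t. (j, i) \<in> W t}"
    proof (rule card_mono)
      have "(t, j) \<notin> R'" if "j \<in> proposers R t" for j
        using that False R' by (auto simp: proposers_def da_points_def best_def)
      then show "{j \<in> proposers R t. (j, i) \<in> W t} \<subseteq> {j \<in> proposers R' t. (j, i) \<in> W t}"
        using proposers_persist[of _ R t R'] R' by auto
    qed auto
    finally show ?thesis .
  next
    case True
    have iI: "i \<in> I"
      using ti R' assms(2) proposers_subset by (auto simp: rejections_justified_def)
    \<comment> \<open>Earlier rejections are covered by the invariant, new ones by the failure to be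
      a top proposer.\<close>
    have cnt: "q s \<le> card {j \<in> proposers R s. (j, i) \<in> W s}"
      using ti True R' assms(2)
      by (fastforce simp: rejections_justified_def top_proposers_def)
    have above: "(j, i) \<in> W s" if j: "j \<in> top_proposers R s" for j
    proof (rule ccontr)
      assume n: "(j, i) \<notin> W s"
      have "j \<in> I" using j proposers_subset by (auto simp: top_proposers_def)
      then have "i = j \<or> (i, j) \<in> W s" using n within_total iI s by auto
      \<comment> \<open>Everyone above \<open>i\<close> would be above \<open>j\<close> as well,
        which is too many for \<open>j\<close> to be a top proposer.\<close>
      then have "{k \<in> proposers R s. (k, i) \<in> W s} \<subseteq> {k \<in> proposers R s. (k, j) \<in> W s}"
        using within_trans s by auto
      then have "card {k \<in> proposers R s. (k, i) \<in> W s} \<le> card {k \<in> proposers R s. (k, j) \<in> W s}"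
        by (intro card_mono) auto
      then show False using j cnt by (auto simp: top_proposers_def)
    qed
    have "(s, j) \<notin> R'" if "j \<in> top_proposers R s" for j
      using that R' by (auto simp: top_proposers_def proposers_def da_points_def best_def)
    then have "top_proposers R s \<subseteq> {j \<in> proposers R' s. (j, i) \<in> W s}"
      using above proposers_persist[of _ R s R'] R' by (auto simp: top_proposers_def)
    then have "card (top_proposers R s) \<le> card {j \<in> proposers R' s. (j, i) \<in> W s}"
      by (intro card_mono) auto
    then show ?thesis using card_top_proposers s True by simp
  qed
  moreover have "R' \<subseteq> S \<times> I"
    using R' assms(2) s proposers_subset by (auto simp: rejections_justified_def)
  ultimately show ?thesis by (auto simp: rejections_justified_def)
qed

text \<open>The measure counts the rejections not yet made. An over-demanded school rejects at least
  one proposer, and no proposer has been rejected by it before.\<close>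

lemma da_result_exists: "\<exists>\<mu>. da_result \<mu>"
proof -
  let ?N = "\<lambda>R. \<forall>s\<in>S. card (proposers R s) \<le> q s"
  have "\<exists>R. da_step\<^sup>*\<^sup>* {} R \<and> R \<subseteq> S \<times> I \<and> ?N R"
  proof (rule terminating_relation_reaches_normal_form
      [where f = "\<lambda>R. card (S \<times> I - R)"])
    fix R assume R: "R \<subseteq> S \<times> I" and "\<not> ?N R"
    then obtain s where s: "s \<in> S" "q s < card (proposers R s)" by auto
    define X where "X = proposers R s - top_proposers R s"
    let ?R' = "R \<union> {s} \<times> X"
    have "card (top_proposers R s) < card (proposers R s)"
      using card_top_proposers s by simp
    moreover have "top_proposers R s \<subseteq> proposers R s" by (auto simp: top_proposers_def)
    ultimately have "X \<noteq> {}" unfolding X_def by auto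
    then obtain x where x: "x \<in> X" by auto
    have X: "X \<subseteq> I" using proposers_subset by (auto simp: X_def)
    have "(s, x) \<notin> R"
      using x by (auto simp: X_def proposers_def da_points_def best_def)
    then have "S \<times> I - ?R' \<subset> S \<times> I - R" using x X s by auto
    then have "card (S \<times> I - ?R') < card (S \<times> I - R)"
      by (intro psubset_card_mono) (auto simp: finite_schools finite_students)
    moreover have "da_step R ?R'" using s by (auto simp: da_step_def X_def)
    moreover have "?R' \<subseteq> S \<times> I" using R s X by auto
    ultimately show "\<exists>R'. da_step R R' \<and> R' \<subseteq> S \<times> I \<and> card (S \<times> I - R') < card (S \<times> I - R)"
      by blast
  qed auto
  then obtain R where R: "da_step\<^sup>*\<^sup>* {} R" "?N R" by auto
  have "\<forall>i\<in>I. \<exists>a. da_points R i a" using da_points_exists by blast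
  then obtain \<mu> where "\<forall>i\<in>I. da_points R i (\<mu> i)" using bchoice[of I] by blast
  then show ?thesis using R by (auto simp: da_result_def)
qed

text \<open>Pairwise stability with respect to \<open>W\<close>: the last clause excludes blocking
  pairs that use a free place or displace a lower-ranked student.\<close>

definition stable :: "('i \<rightharpoonup> 's) \<Rightarrow> bool" where
  "stable \<mu> \<longleftrightarrow> is_match \<mu> \<and> (\<forall>i\<in>I. (\<mu> i, None) \<in> (P i)\<^sup>=) \<and>
     (\<forall>i\<in>I. \<forall>s\<in>S. (Some s, \<mu> i) \<in> P i \<longrightarrow>
        card (assigned \<mu> s) = q s \<and> (\<forall>j\<in>assigned \<mu> s. (j, i) \<in> W s))"

text \<open>A school preferred to the final proposal must have rejected \<open>i\<close>, since
  otherwise it would still be on her menu. Then \<open>q s\<close> of its at most \<open>q s\<close>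
  students outrank her, so all of them do.\<close>

lemma da_result_stable:
  assumes "da_result \<mu>"
  shows "stable \<mu>"
proof -
  obtain R where steps: "da_step\<^sup>*\<^sup>* {} R" and cap: "\<forall>s\<in>S. card (proposers R s) \<le> q s"
    and \<mu>: "\<forall>i\<in>I. da_points R i (\<mu> i)"
    using assms by (auto simp: da_result_def)
  have just: "rejections_justified R"
    using steps
    by (induction rule: rtranclp_induct)
      (auto intro: da_step_rejections_justified simp: rejections_justified_def[of "{}"])
  have assigned: "assigned \<mu> s = proposers R s" for s
    using \<mu> da_points_unique by (auto simp: assigned_def proposers_def)
  have "card (assigned \<mu> s) = q s \<and> (\<forall>j\<in>assigned \<mu> s. (j, i) \<in> W s)"
    if i: "i \<in> I" and s: "s \<in> S" and pref: "(Some s, \<mu> i) \<in> P i" for i s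
  proof -
    have "(s, i) \<in> R"
    proof (rule ccontr)
      assume "(s, i) \<notin> R"
      then have "Some s = \<mu> i \<or> (\<mu> i, Some s) \<in> P i"
        using \<mu> i s by (auto simp: da_points_def best_def)
      then show False using pref i preference_trans preference_irrefl by metis
    qed
    then have le: "q s \<le> card {j \<in> assigned \<mu> s. (j, i) \<in> W s}"
      using just assigned by (auto simp: rejections_justified_def)
    have "card (assigned \<mu> s) \<le> q s" using cap s assigned by auto
    then have "{j \<in> assigned \<mu> s. (j, i) \<in> W s} = assigned \<mu> s"
      using le by (intro card_seteq) auto
    then show ?thesis using le cap s assigned by (metis (no_types, lifting) le_antisym mem_Collect_eq)
  qed
  moreover have "is_match \<mu>"
    using \<mu> cap assigned by (fastforce simp: is_match_def da_points_def best_def)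
  moreover have "\<forall>i\<in>I. (\<mu> i, None) \<in> (P i)\<^sup>="
    using \<mu> by (auto simp: da_points_def best_def)
  ultimately show ?thesis by (auto simp: stable_def)
qed

subsection \<open>Top Trading Cycles\<close>

lemma initially_active_subset: "initially_active \<mu>1 \<subseteq> I"
  by (auto simp: initially_active_def)

lemma finite_initially_active: "finite (initially_active \<mu>1)"
  using initially_active_subset finite_students by (rule finite_subset)

lemma initially_activeE:
  assumes "i \<in> A" "A \<subseteq> initially_active \<mu>1"
  obtains s where "i \<in> I" "s \<in> S" "\<mu>1 i = Some s" "i \<in> assigned \<mu>1 s \<inter> A"
    "s \<in> active_schools \<mu>1 A"
proof -
  have "i \<in> initially_active \<mu>1" using assms by auto
  then obtain s where s: "i \<in> I" "s \<in> S" "\<mu>1 i = Some s"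
    by (auto simp: initially_active_def)
  then have "i \<in> assigned \<mu>1 s \<inter> A" using assms by (auto simp: assigned_def)
  then show thesis using that s by (auto simp: active_schools_def)
qed

lemma student_points_exists:
  assumes "i \<in> A" "A \<subseteq> initially_active \<mu>1"
  shows "\<exists>s. student_points \<mu>1 A i s"
proof -
  obtain s where s: "i \<in> I" "s \<in> S" "i \<in> assigned \<mu>1 s \<inter> A" "s \<in> active_schools \<mu>1 A"
    using initially_activeE[OF assms] by metis
  let ?X = "Some ` {t \<in> active_schools \<mu>1 A. \<exists>j\<in>assigned \<mu>1 t \<inter> A. indifferent t i j}"
  have "?X \<subseteq> Some ` S" by (auto simp: active_schools_def)
  then have "finite ?X" using finite_schools by (meson finite_imageI finite_subset)
  \<comment> \<open>Her own school is available, with herself as the active tied student.\<close>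
  moreover have "Some s \<in> ?X"
    using s between_refl by (auto simp: indifferent_def)
  then have "?X \<noteq> {}" by blast
  moreover have "?X \<subseteq> insert None (Some ` S)" by (auto simp: active_schools_def)
  ultimately have "\<exists>a. best (P i) ?X a"
    by (rule best_exists[OF _ _ _ preference_order[OF s(1)]])
  then obtain a where a: "best (P i) ?X a" ..
  then obtain t where "a = Some t" by (auto simp: best_def)
  then show ?thesis using a unfolding student_points_def by blast
qed

lemma school_points_exists:
  assumes "s \<in> active_schools \<mu>1 A"
  shows "\<exists>i. school_points \<mu>1 A s i"
  unfolding school_points_def
proof (rule best_exists[OF _ _ _ within_order])
  show "assigned \<mu>1 s \<inter> A \<subseteq> I" using assigned_subset by auto
qed (use assms in \<open>auto simp: active_schools_def\<close>)

text \<open>Following the student's pointer and then the school's pointer is a self-map of the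
  finite set of active students; a cycle of this map is a trading cycle.\<close>

lemma ttc_cycle_exists:
  assumes "A \<noteq> {}" "A \<subseteq> initially_active \<mu>1"
  shows "\<exists>js ss. ttc_cycle \<mu>1 A js ss"
proof -
  have "\<forall>i\<in>A. \<exists>s. student_points \<mu>1 A i s" using student_points_exists assms(2) by blast
  then obtain p where p: "\<forall>i\<in>A. student_points \<mu>1 A i (p i)" using bchoice by metis
  have "\<forall>s\<in>active_schools \<mu>1 A. \<exists>i. school_points \<mu>1 A s i" using school_points_exists by blast
  then obtain h where h: "\<forall>s\<in>active_schools \<mu>1 A. school_points \<mu>1 A s (h s)"
    using bchoice by metis
  have pA: "p i \<in> active_schools \<mu>1 A" if "i \<in> A" for i
    using p that by (auto simp: student_points_def best_def)
  have hA: "h s \<in> A" if "s \<in> active_schools \<mu>1 A" for s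
    using h that by (auto simp: school_points_def best_def)
  obtain a where a: "a \<in> A" using assms(1) by auto
  have finA: "finite A" using assms(2) finite_initially_active by (rule finite_subset)
  have "(\<lambda>i. h (p i)) ` A \<subseteq> A" using pA hA by auto
  then obtain js where js: "js \<noteq> []" "distinct js" "set js \<subseteq> A"
      "\<And>k. k < length js \<Longrightarrow> h (p (js ! k)) = js ! (Suc k mod length js)"
    using finite_orbit_cycle[OF finA a] by metis
  have "inj_on p (set js)"
  proof -
    \<comment> \<open>The self-map merely rotates the distinct list \<open>js\<close>, so its first
      factor \<open>p\<close> repeats no school there.\<close>
    have "map (\<lambda>i. h (p i)) js = rotate1 js"
      using js(4) by (intro nth_equalityI) (auto simp: nth_rotate1)
    then have "distinct (map h (map p js))" using js(2) by (simp add: comp_def)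
    then have "distinct (map p js)" by (metis distinct_map)
    then show ?thesis by (simp add: distinct_map)
  qed
  then have "distinct (map p js)" using js(2) by (simp add: distinct_map)
  moreover have "set (map p js) \<subseteq> active_schools \<mu>1 A" using pA js(3) by auto
  moreover have "student_points \<mu>1 A (js ! k) (map p js ! k) \<and>
      school_points \<mu>1 A (map p js ! k) (js ! (Suc k mod length js))" if "k < length js" for k
    using that p h pA js(3,4) nth_mem[OF that] by (metis nth_map subsetD)
  ultimately have "ttc_cycle \<mu>1 A js (map p js)"
    using js by (auto simp: ttc_cycle_def)
  then show ?thesis by blast
qed

lemma ttc_step_iff:
  "ttc_step \<mu>1 (A, \<mu>) y \<longleftrightarrow>
    (\<exists>js ss. ttc_cycle \<mu>1 A js ss \<and> y = (A - set js, \<mu>(js [\<mapsto>] ss)))"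
  unfolding ttc_step_def by (cases y) simp

lemma ttc_result_exists: "\<exists>\<mu>2. ttc_result \<mu>1 \<mu>2"
proof -
  have "\<exists>y :: 'i set \<times> ('i \<rightharpoonup> 's). (ttc_step \<mu>1)\<^sup>*\<^sup>* (initially_active \<mu>1, \<mu>1) y \<and>
      fst y \<subseteq> initially_active \<mu>1 \<and> fst y = {}"
  proof (rule terminating_relation_reaches_normal_form[where f = "\<lambda>x. card (fst x)" and
        Q = "\<lambda>x. fst x \<subseteq> initially_active \<mu>1"])
    fix x :: "'i set \<times> ('i \<rightharpoonup> 's)"
    assume x: "fst x \<subseteq> initially_active \<mu>1" "fst x \<noteq> {}"
    obtain A \<mu> where [simp]: "x = (A, \<mu>)" by (cases x)
    obtain js ss where c: "ttc_cycle \<mu>1 A js ss" using ttc_cycle_exists[of A \<mu>1] x by auto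
    have "finite A" using x finite_initially_active finite_subset by auto
    moreover have "hd js \<in> set js" "set js \<subseteq> A" using c by (auto simp: ttc_cycle_def)
    then have "A - set js \<subset> A" by blast
    ultimately have "card (A - set js) < card A" by (rule psubset_card_mono)
    moreover have "ttc_step \<mu>1 x (A - set js, \<mu>(js [\<mapsto>] ss))"
      using c unfolding \<open>x = _\<close> ttc_step_iff by blast
    moreover have "A - set js \<subseteq> initially_active \<mu>1" using x by auto
    ultimately show "\<exists>y. ttc_step \<mu>1 x y \<and> fst y \<subseteq> initially_active \<mu>1 \<and> card (fst y) < card (fst x)"
      by (intro exI[of _ "(A - set js, \<mu>(js [\<mapsto>] ss))"]) simp
  qed simp
  then obtain A \<mu>2 where "(ttc_step \<mu>1)\<^sup>*\<^sup>* (initially_active \<mu>1, \<mu>1) (A, \<mu>2)" "A = {}"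
    by (metis prod.collapse)
  then show ?thesis unfolding ttc_result_def by blast
qed

text \<open>The departed students are \<open>initially_active \<mu>1 - A\<close>. The cardinality
  clause says that they have permuted their \<open>\<mu>1\<close>-places among themselves; as a
  count per value it adds up over cycles. The tied student \<open>j\<close> is sought among the
  initially active ones, so later departures do not affect the last clause.\<close>

definition ttc_invariant :: "('i \<rightharpoonup> 's) \<Rightarrow> 'i set \<Rightarrow> ('i \<rightharpoonup> 's) \<Rightarrow> bool" where
  "ttc_invariant \<mu>1 A \<mu> \<longleftrightarrow>
     A \<subseteq> initially_active \<mu>1 \<and>
     (\<forall>i. i \<notin> initially_active \<mu>1 - A \<longrightarrow> \<mu> i = \<mu>1 i) \<and>
     (\<forall>a. card {i \<in> initially_active \<mu>1 - A. \<mu> i = a} =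
          card {i \<in> initially_active \<mu>1 - A. \<mu>1 i = a}) \<and>
     (\<forall>i\<in>initially_active \<mu>1 - A. (\<mu> i, \<mu>1 i) \<in> (P i)\<^sup>= \<and>
        (\<exists>s\<in>S. \<mu> i = Some s \<and> (\<exists>j\<in>assigned \<mu>1 s \<inter> initially_active \<mu>1. indifferent s i j)))"

lemma ttc_cycle_nth:
  assumes "ttc_cycle \<mu>1 A js ss" "k < length js"
  shows "ss ! k \<in> S" "student_points \<mu>1 A (js ! k) (ss ! k)"
    "js ! (Suc k mod length js) \<in> assigned \<mu>1 (ss ! k) \<inter> A"
    "(\<mu>(js [\<mapsto>] ss)) (js ! k) = Some (ss ! k)"
proof -
  have c: "length ss = length js" "distinct js" "set ss \<subseteq> active_schools \<mu>1 A"
    and p: "student_points \<mu>1 A (js ! k) (ss ! k)"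
      "school_points \<mu>1 A (ss ! k) (js ! (Suc k mod length js))"
    using assms unfolding ttc_cycle_def by blast+
  have "ss ! k \<in> set ss" using assms(2) c(1) by simp
  then show "ss ! k \<in> S" using c(3) by (auto simp: active_schools_def)
  show "student_points \<mu>1 A (js ! k) (ss ! k)" by (rule p)
  show "js ! (Suc k mod length js) \<in> assigned \<mu>1 (ss ! k) \<inter> A"
    using p(2) by (simp add: school_points_def best_def)
  show "(\<mu>(js [\<mapsto>] ss)) (js ! k) = Some (ss ! k)"
    using c(1,2) assms(2) by (simp add: map_upds_nth)
qed

lemma student_points_weakly_prefers:
  assumes "student_points \<mu>1 A i s" "t \<in> S" "j \<in> assigned \<mu>1 t \<inter> A" "indifferent t i j"
  shows "(Some s, Some t) \<in> (P i)\<^sup>="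
proof -
  have "t \<in> {t \<in> active_schools \<mu>1 A. \<exists>j\<in>assigned \<mu>1 t \<inter> A. indifferent t i j}"
    using assms(2-4) unfolding active_schools_def by blast
  then show ?thesis
    by (rule best_weakly_above[OF assms(1)[unfolded student_points_def] imageI])
qed

text \<open>The schools \<open>ss\<close> handed out by the cycle are, up to rotation, those its
  students held in \<open>\<mu>1\<close>, which preserves the counts. A student may always point to
  her own school, so trading is no loss.\<close>

lemma ttc_step_invariant:
  assumes inv: "ttc_invariant \<mu>1 A \<mu>" and cyc: "ttc_cycle \<mu>1 A js ss"
  shows "ttc_invariant \<mu>1 (A - set js) (\<mu>(js [\<mapsto>] ss))"
proof -
  let ?A0 = "initially_active \<mu>1" and ?\<mu>' = "\<mu>(js [\<mapsto>] ss)"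
  let ?ok = "\<lambda>\<mu> i. (\<mu> i, \<mu>1 i) \<in> (P i)\<^sup>= \<and>
    (\<exists>s\<in>S. \<mu> i = Some s \<and> (\<exists>j\<in>assigned \<mu>1 s \<inter> ?A0. indifferent s i j))"
  note nth = ttc_cycle_nth[OF cyc]
  have A: "A \<subseteq> ?A0"
    and unchanged: "\<And>i. i \<notin> ?A0 - A \<Longrightarrow> \<mu> i = \<mu>1 i"
    and cards: "\<And>a. card {i \<in> ?A0 - A. \<mu> i = a} = card {i \<in> ?A0 - A. \<mu>1 i = a}"
    and ok: "\<And>i. i \<in> ?A0 - A \<Longrightarrow> ?ok \<mu> i"
    using inv unfolding ttc_invariant_def by simp_all
  have js: "set js \<subseteq> A" "distinct js" "length ss = length js"
    using cyc unfolding ttc_cycle_def by blast+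
  have keep: "?\<mu>' i = \<mu> i" if "i \<notin> set js" for i
    using that by (rule map_upds_apply_nontin)
  have split: "card {i \<in> ?A0 - (A - set js). f i = a} =
      card {i \<in> ?A0 - A. f i = a} + count_list (map f js) a" for f :: "'i \<rightharpoonup> 's" and a
  proof -
    have "{i \<in> ?A0 - (A - set js). f i = a} = {i \<in> ?A0 - A. f i = a} \<union> {i \<in> set js. f i = a}"
      using js A by blast
    moreover have "{i \<in> ?A0 - A. f i = a} \<inter> {i \<in> set js. f i = a} = {}" using js by blast
    ultimately show ?thesis
      using card_preimage_distinct_list[OF js(2), of f a] finite_initially_active
      by (simp add: card_Un_disjoint)
  qed
  have new: "map ?\<mu>' js = map Some ss"
    using js(3) nth(4) by (intro nth_equalityI) simp_all
  have "\<mu>1 (js ! (Suc k mod length js)) = Some (ss ! k)" if "k < length js" for k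
    using nth(3)[OF that] by (simp add: assigned_def)
  \<comment> \<open>A school points to its own student at the next position, hence the shift by
    one.\<close>
  then have old: "map \<mu>1 (rotate1 js) = map Some ss"
    using js(3) by (intro nth_equalityI) (simp_all add: nth_rotate1)
  have "card {i \<in> ?A0 - (A - set js). ?\<mu>' i = a} =
      card {i \<in> ?A0 - (A - set js). \<mu>1 i = a}" for a
  proof -
    have "{i \<in> ?A0 - A. ?\<mu>' i = a} = {i \<in> ?A0 - A. \<mu> i = a}"
      using js(1) keep by (metis (no_types, lifting) DiffE subsetD)
    moreover have "count_list (map \<mu>1 js) a = count_list (map \<mu>1 (rotate1 js)) a"
      by (cases js) auto
    ultimately show ?thesis unfolding split new old by (simp only: cards)
  qed
  moreover have "?\<mu>' i = \<mu>1 i" if "i \<notin> ?A0 - (A - set js)" for i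
  proof -
    have "i \<notin> set js" "i \<notin> ?A0 - A" using that js(1) A by blast+
    then show ?thesis using keep unchanged by simp
  qed
  moreover have "?ok ?\<mu>' i" if i: "i \<in> ?A0 - (A - set js)" for i
  proof (cases "i \<in> set js")
    case True
    then obtain k where k: "k < length js" "i = js ! k" by (auto simp: in_set_conv_nth)
    have v: "?\<mu>' i = Some (ss ! k)" "ss ! k \<in> S" and sp: "student_points \<mu>1 A i (ss ! k)"
      using nth k by simp_all
    have "i \<in> A" using True js by blast
    then obtain s where s: "i \<in> I" "s \<in> S" "\<mu>1 i = Some s" "i \<in> assigned \<mu>1 s \<inter> A"
      by (rule initially_activeE[OF _ A])
    have "indifferent s i i" using s between_refl by (simp add: indifferent_def)
    then have "(Some (ss ! k), Some s) \<in> (P i)\<^sup>="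
      by (rule student_points_weakly_prefers[OF sp s(2,4)])
    moreover obtain j where "j \<in> assigned \<mu>1 (ss ! k) \<inter> A" "indifferent (ss ! k) i j"
      using sp by (auto simp: student_points_def best_def)
    ultimately show ?thesis using v s A by auto
  next
    case False
    then show ?thesis using i ok[of i] keep by simp
  qed
  ultimately show ?thesis using A unfolding ttc_invariant_def by blast
qed

lemma ttc_invariant_init: "ttc_invariant \<mu>1 (initially_active \<mu>1) \<mu>1"
  by (auto simp: ttc_invariant_def)

text \<open>Later cycles reassign active students only.\<close>

lemma ttc_departed_fixed:
  assumes "(ttc_step \<mu>1)\<^sup>*\<^sup>* (A, \<mu>) ({}, \<mu>2)" "i \<notin> A"
  shows "\<mu>2 i = \<mu> i"
proof -
  have "snd y i = snd x i" if "(ttc_step \<mu>1)\<^sup>*\<^sup>* x y" "i \<notin> fst x" for x y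
    using that
  proof (induction rule: converse_rtranclp_induct)
    case (step x z)
    obtain A \<mu> where x: "x = (A, \<mu>)" by (cases x)
    obtain js ss where "ttc_cycle \<mu>1 A js ss" and z: "z = (A - set js, \<mu>(js [\<mapsto>] ss))"
      using step.hyps(1) unfolding x ttc_step_iff by blast
    then have "i \<notin> set js" using step.prems x by (auto simp: ttc_cycle_def)
    then show ?case using step x z by (simp add: map_upds_apply_nontin)
  qed simp
  then show ?thesis using assms by force
qed

text \<open>Induction along a run which also supplies that the assignments of each executed cycle
  are final. The underlying converse induction keeps the remaining run to
  \<open>({}, \<mu>2)\<close> at hand, and \<open>ttc_departed_fixed\<close> applies to it.\<close>

lemma ttc_result_induct [consumes 1, case_names start cycle]:
  assumes "ttc_result \<mu>1 \<mu>2"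
    and "Q (initially_active \<mu>1) \<mu>1"
    and "\<And>A \<mu> js ss. \<lbrakk>Q A \<mu>; ttc_invariant \<mu>1 A \<mu>; ttc_cycle \<mu>1 A js ss;
      \<And>k. k < length js \<Longrightarrow> \<mu>2 (js ! k) = Some (ss ! k)\<rbrakk> \<Longrightarrow> Q (A - set js) (\<mu>(js [\<mapsto>] ss))"
  shows "ttc_invariant \<mu>1 {} \<mu>2 \<and> Q {} \<mu>2"
proof -
  have "ttc_invariant \<mu>1 (fst x) (snd x) \<Longrightarrow> Q (fst x) (snd x) \<Longrightarrow>
      ttc_invariant \<mu>1 {} \<mu>2 \<and> Q {} \<mu>2"
    if "(ttc_step \<mu>1)\<^sup>*\<^sup>* x ({}, \<mu>2)" for x
    using that
  proof (induction rule: converse_rtranclp_induct)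
    case (step x z)
    obtain A \<mu> where x: "x = (A, \<mu>)" by (cases x)
    obtain js ss where c: "ttc_cycle \<mu>1 A js ss" and z: "z = (A - set js, \<mu>(js [\<mapsto>] ss))"
      using step.hyps(1) unfolding x ttc_step_iff by blast
    have "\<mu>2 (js ! k) = Some (ss ! k)" if "k < length js" for k
      using ttc_departed_fixed step.hyps(2) z ttc_cycle_nth(4)[OF c that] that
      by (metis DiffE nth_mem)
    then show ?case
      using step.IH step.prems x z c assms(3) ttc_step_invariant by simp
  qed simp
  from this[of "(initially_active \<mu>1, \<mu>1)"] show ?thesis
    using assms(1,2) ttc_invariant_init unfolding ttc_result_def by simp
qed

lemma ttc_result_invariant: "ttc_result \<mu>1 \<mu>2 \<Longrightarrow> ttc_invariant \<mu>1 {} \<mu>2"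
  using ttc_result_induct[where Q = "\<lambda>_ _. True"] by blast

lemma ttc_weakly_improves:
  assumes "ttc_result \<mu>1 \<mu>2"
  shows "(\<mu>2 i, \<mu>1 i) \<in> (P i)\<^sup>="
  using ttc_result_invariant[OF assms] unfolding ttc_invariant_def by blast

lemma card_ttc_reassigned:
  assumes "ttc_result \<mu>1 \<mu>2"
  shows "card {i \<in> initially_active \<mu>1. \<mu>2 i = a} = card {i \<in> initially_active \<mu>1. \<mu>1 i = a}"
  using ttc_result_invariant[OF assms] unfolding ttc_invariant_def Diff_empty by blast

lemma ttc_unchanged: "ttc_result \<mu>1 \<mu>2 \<Longrightarrow> i \<notin> initially_active \<mu>1 \<Longrightarrow> \<mu>2 i = \<mu>1 i"
  using ttc_result_invariant unfolding ttc_invariant_def by blast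

text \<open>Students outside \<open>initially_active \<mu>1\<close> stay where they are; the others
  permute their places.\<close>

lemma card_ttc_assigned:
  assumes "ttc_result \<mu>1 \<mu>2"
  shows "card (assigned \<mu>2 s) = card (assigned \<mu>1 s)"
proof -
  let ?A0 = "initially_active \<mu>1"
  let ?X = "{i \<in> I - ?A0. \<mu>1 i = Some s}"
  have fin: "finite ?X" "finite {i \<in> ?A0. f i = Some s}" for f :: "'i \<rightharpoonup> 's"
    using finite_students finite_initially_active by auto
  have "assigned \<mu>1 s = {i \<in> ?A0. \<mu>1 i = Some s} \<union> ?X"
    using initially_active_subset by (auto simp: assigned_def)
  moreover have "assigned \<mu>2 s = {i \<in> ?A0. \<mu>2 i = Some s} \<union> ?X"
    using initially_active_subset ttc_unchanged[OF assms] by (auto simp: assigned_def)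
  ultimately show ?thesis
    using card_ttc_reassigned[OF assms, of "Some s"] fin
    by (simp add: card_Un_disjoint disjoint_iff)
qed

lemma ttc_reassigned_bottom:
  assumes "ttc_result \<mu>1 \<mu>2" "i \<in> initially_active \<mu>1" "\<mu>2 i = Some s"
  obtains j where "j \<in> assigned \<mu>1 s \<inter> initially_active \<mu>1" "indifferent s i j"
  using ttc_result_invariant[OF assms(1)] assms(2,3) that unfolding ttc_invariant_def by fastforce

text \<open>An initially active student ties with the bottom class of her new school; any other has
  kept her school and is her own witness.\<close>

lemma ttc_assigned_indifferent:
  assumes "ttc_result \<mu>1 \<mu>2" "s \<in> S" "i \<in> assigned \<mu>2 s"
  obtains j where "j \<in> assigned \<mu>1 s" "indifferent s i j"
proof (cases "i \<in> initially_active \<mu>1")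
  case True
  then obtain j where "j \<in> assigned \<mu>1 s \<inter> initially_active \<mu>1" "indifferent s i j"
    using ttc_reassigned_bottom[OF assms(1)] assms(3) by (auto simp: assigned_def)
  then show thesis using that by blast
next
  case False
  then have "i \<in> assigned \<mu>1 s"
    using assms(3) ttc_unchanged[OF assms(1)] by (simp add: assigned_def)
  then show thesis
    using that between_refl assms(2) by (auto simp: indifferent_def assigned_def)
qed

lemma ttc_result_match:
  assumes "is_match \<mu>1" "ttc_result \<mu>1 \<mu>2"
  shows "is_match \<mu>2"
proof -
  have "\<mu>2 i \<in> insert None (Some ` S)" if "i \<in> I" for i
  proof (cases "i \<in> initially_active \<mu>1")
    case True
    then show ?thesis
      using ttc_result_invariant[OF assms(2)] unfolding ttc_invariant_def by fastforce
  next
    case False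
    then show ?thesis
      using that assms ttc_unchanged[OF assms(2)] by (simp add: is_match_def)
  qed
  then show ?thesis
    using assms(1) card_ttc_assigned[OF assms(2)] by (simp add: is_match_def)
qed

section \<open>Consequences of stability and between-group blocking\<close>

lemma preference_chain:
  assumes "i \<in> I" "(a, b) \<in> P i" "(b, c) \<in> (P i)\<^sup>="
  shows "(a, c) \<in> P i"
  using assms preference_trans by auto

text \<open>Individual rationality of \<open>\<mu>1\<close> puts \<open>a\<close> above remaining
  unmatched, so \<open>a\<close> is a school and stability applies to it.\<close>

lemma stable_improvement:
  assumes "stable \<mu>1" "i \<in> I" "(a, \<mu>1 i) \<in> P i"
  obtains s where "a = Some s" "s \<in> S" "card (assigned \<mu>1 s) = q s"
    "\<And>j. j \<in> assigned \<mu>1 s \<Longrightarrow> (j, i) \<in> W s"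
proof -
  have "(\<mu>1 i, None) \<in> (P i)\<^sup>=" using assms by (simp add: stable_def)
  then have "(a, None) \<in> P i" by (rule preference_chain[OF assms(2,3)])
  then have "a \<noteq> None" using preference_irrefl[OF assms(2)] by metis
  moreover have "a \<in> insert None (Some ` S)"
    using preference_carrier assms(2,3) by auto
  ultimately obtain s where s: "a = Some s" "s \<in> S" by auto
  then have "card (assigned \<mu>1 s) = q s \<and> (\<forall>j\<in>assigned \<mu>1 s. (j, i) \<in> W s)"
    using assms unfolding stable_def by blast
  then show thesis using that s by blast
qed

lemma not_between_blocked:
  assumes "stable \<mu>1" "ttc_result \<mu>1 \<mu>2" "C \<subseteq> I"
  shows "\<not> between_blocks C \<mu>2"
proof
  assume "between_blocks C \<mu>2"
  then obtain \<nu> where enf: "between_enforces C \<nu> \<mu>2" and "coalition_prefers C \<nu> \<mu>2"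
    by (auto simp: between_blocks_def)
  then obtain i where i: "i \<in> C" "(\<nu> i, \<mu>2 i) \<in> P i" by (auto simp: coalition_prefers_def)
  have "i \<in> I" using i assms(3) by auto
  moreover have "(\<nu> i, \<mu>1 i) \<in> P i"
    using preference_chain[OF _ i(2) ttc_weakly_improves[OF assms(2)]] \<open>i \<in> I\<close> by blast
  ultimately obtain s where s: "\<nu> i = Some s" "s \<in> S" "card (assigned \<mu>1 s) = q s"
    "\<And>j. j \<in> assigned \<mu>1 s \<Longrightarrow> (j, i) \<in> W s"
    using stable_improvement[OF assms(1)] by metis
  \<comment> \<open>The school is full under \<open>\<mu>1\<close>, hence under
    \<open>\<mu>2\<close>, which excludes enforcement by a free place.\<close>
  then obtain j where j: "j \<in> assigned \<mu>2 s" "strictly_above s i j"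
    using enf i(1) card_ttc_assigned[OF assms(2)] by (fastforce simp: between_enforces_def)
  obtain k where k: "k \<in> assigned \<mu>1 s" "indifferent s j k"
    using ttc_assigned_indifferent[OF assms(2) s(2) j(1)] .
  \<comment> \<open>\<open>k\<close> is held by \<open>s\<close> under \<open>\<mu>1\<close> and
    therefore ranks above \<open>i\<close>; so does \<open>j\<close>, being tied with
    \<open>k\<close>.\<close>
  have "(k, i) \<in> B s" using within_imp_between s k by blast
  then have "(j, i) \<in> B s" using k(2) between_trans[OF s(2)] by (auto simp: indifferent_def)
  then show False using j(2) by (simp add: strictly_above_def)
qed

end

subsection \<open>Within-group blocking\<close>

text \<open>The coalition is assumed to prefer \<open>\<nu>\<close> weakly; that no member gains
  strictly is the conclusion reached in \<open>no_strict_improvement\<close>.\<close>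

locale within_deviation = school_choice I S q P B W
  for I :: "'i set" and S :: "'s set" and q :: "'s \<Rightarrow> nat"
    and P :: "'i \<Rightarrow> 's option rel" and B :: "'s \<Rightarrow> 'i rel" and W :: "'s \<Rightarrow> 'i rel" +
  fixes \<mu>1 \<mu>2 \<nu> :: "'i \<rightharpoonup> 's" and C :: "'i set"
  assumes stable: "stable \<mu>1"
    and result: "ttc_result \<mu>1 \<mu>2"
    and coalition: "C \<subseteq> I"
    and enforced: "within_enforces C \<nu> \<mu>2"
    and weakly_preferred: "i \<in> C \<Longrightarrow> (\<nu> i, \<mu>2 i) \<in> (P i)\<^sup>="
begin

text \<open>The comparison is with \<open>\<mu>1\<close> and not \<open>\<mu>2\<close>, because it
  is \<open>\<mu>1\<close> that is stable. Members whose gain is already realized by trading are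
  thus included.\<close>

definition improvers :: "'i set" where
  "improvers = {i \<in> C. (\<nu> i, \<mu>1 i) \<in> P i}"

definition sought :: "'s set" where
  "sought = {s. \<exists>i\<in>improvers. \<nu> i = Some s}"

text \<open>The lowest between-group class of the \<open>\<mu>1\<close>-students of a school, see
  \<open>bottom_eq\<close>.\<close>

definition bottom :: "'s \<Rightarrow> 'i set" where
  "bottom s = assigned \<mu>1 s \<inter> initially_active \<mu>1"

lemma improvers_coalition: "i \<in> improvers \<Longrightarrow> i \<in> C \<and> i \<in> I"
  using coalition by (auto simp: improvers_def)

lemma bottom_eq: "s \<in> S \<Longrightarrow> bottom s = {i \<in> assigned \<mu>1 s. \<forall>j\<in>assigned \<mu>1 s. (j, i) \<in> B s}"
  by (auto simp: bottom_def initially_active_def assigned_def)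

lemma improver_seeks:
  assumes "i \<in> improvers"
  obtains s where "\<nu> i = Some s" "s \<in> S" "s \<in> sought"
proof -
  have i: "i \<in> I" "(\<nu> i, \<mu>1 i) \<in> P i"
    using assms improvers_coalition[OF assms] by (simp_all add: improvers_def)
  show thesis
  proof (rule stable_improvement[OF stable i])
    fix s assume "\<nu> i = Some s" "s \<in> S"
    then show thesis using that assms unfolding sought_def by blast
  qed
qed

lemma sought_properties:
  assumes "i \<in> improvers" "\<nu> i = Some s"
  shows "s \<in> S" "card (assigned \<mu>1 s) = q s" "\<And>j. j \<in> assigned \<mu>1 s \<Longrightarrow> (j, i) \<in> W s"
proof -
  have i: "i \<in> I" "(Some s, \<mu>1 i) \<in> P i"
    using assms improvers_coalition[OF assms(1)] by (simp_all add: improvers_def)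
  obtain t where "Some s = Some t" "t \<in> S" "card (assigned \<mu>1 t) = q t"
      "\<And>j. j \<in> assigned \<mu>1 t \<Longrightarrow> (j, i) \<in> W t"
    using stable_improvement[OF stable i] by metis
  then show "s \<in> S" "card (assigned \<mu>1 s) = q s" "\<And>j. j \<in> assigned \<mu>1 s \<Longrightarrow> (j, i) \<in> W s"
    by simp_all
qed

lemma enforcedD:
  assumes "i \<in> improvers" "\<nu> i = Some s"
  shows "set_weakly_above s (assigned \<nu> s) (assigned \<mu>2 s)"
    "(\<Sum>i\<in>{i \<in> C. \<nu> i = Some s}. card (interrupters C s i)) \<le> q s - card (assigned \<nu> s)"
proof -
  have "Some s \<in> \<nu> ` C" using assms improvers_coalition by force
  then show "set_weakly_above s (assigned \<nu> s) (assigned \<mu>2 s)"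
    "(\<Sum>i\<in>{i \<in> C. \<nu> i = Some s}. card (interrupters C s i)) \<le> q s - card (assigned \<nu> s)"
    using enforced sought_properties(1)[OF assms]
    unfolding within_enforces_def set_indifferent_def by blast+
qed

text \<open>A sought school is full, which leaves no room for interrupters.\<close>

lemma upper_group_coalition:
  assumes "i \<in> improvers" "\<nu> i = Some s"
  shows "upper_group s i \<subseteq> C"
proof -
  obtain f where "bij_betw f (assigned \<nu> s) (assigned \<mu>2 s)"
    using enforcedD(1)[OF assms] by (auto simp: set_weakly_above_def)
  then have "card (assigned \<nu> s) = q s"
    using bij_betw_same_card card_ttc_assigned[OF result] sought_properties(2)[OF assms] by metis
  then have "(\<Sum>i\<in>{i \<in> C. \<nu> i = Some s}. card (interrupters C s i)) = 0"
    using enforcedD(2)[OF assms] by simp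
  moreover have "finite {i \<in> C. \<nu> i = Some s}"
    using coalition finite_students by (auto intro: finite_subset)
  ultimately have "card (interrupters C s i) = 0"
    using assms improvers_coalition by auto
  moreover have "finite (interrupters C s i)"
    using finite_students
    by (auto simp: interrupters_def upper_group_def priority_group_def)
  ultimately show ?thesis by (simp add: interrupters_def)
qed

text \<open>Stability puts all \<open>\<mu>1\<close>-students of \<open>s\<close> weakly above
  \<open>i\<close>. The bijection puts \<open>i\<close> weakly above some
  \<open>\<mu>2\<close>-student, who ties with a \<open>\<mu>1\<close>-student \<open>k\<close>.
  Squeezed in this way, \<open>k\<close> is in the bottom class and \<open>i\<close> ties with
  it.\<close>

lemma bottom_indifferent:
  assumes "i \<in> improvers" "\<nu> i = Some s"
  shows "bottom s \<noteq> {}" "j \<in> bottom s \<Longrightarrow> indifferent s i j"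
proof -
  note s = sought_properties[OF assms]
  have above: "(j, i) \<in> B s" if "j \<in> assigned \<mu>1 s" for j
    using that s within_imp_between by blast
  obtain f where f: "bij_betw f (assigned \<nu> s) (assigned \<mu>2 s)"
      "\<forall>a\<in>assigned \<nu> s. (a, f a) \<in> B s"
    using enforcedD(1)[OF assms] by (auto simp: set_weakly_above_def)
  have "i \<in> assigned \<nu> s" using assms improvers_coalition by (simp add: assigned_def)
  then have "f i \<in> assigned \<mu>2 s" "(i, f i) \<in> B s" using f bij_betwE by blast+
  moreover obtain k where k: "k \<in> assigned \<mu>1 s" "indifferent s (f i) k"
    using ttc_assigned_indifferent[OF result s(1) \<open>f i \<in> _\<close>] .
  ultimately have ik: "(i, k) \<in> B s"
    using between_trans[OF s(1)] by (auto simp: indifferent_def)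
  then have "k \<in> bottom s"
    using k(1) above between_trans[OF s(1)] by (auto simp: bottom_eq[OF s(1)])
  then show "bottom s \<noteq> {}" by auto
  assume j: "j \<in> bottom s"
  then have "(k, j) \<in> B s" "(j, i) \<in> B s"
    using k(1) above by (auto simp: bottom_eq[OF s(1)])
  then show "indifferent s i j"
    using between_trans[OF s(1) ik] by (simp add: indifferent_def)
qed

text \<open>The bottom class ties with an improver and has higher within-group priority, so it lies
  in her upper group.\<close>

lemma bottom_coalition:
  assumes "s \<in> sought"
  shows "bottom s \<subseteq> C"
proof -
  obtain i where i: "i \<in> improvers" "\<nu> i = Some s" using assms by (auto simp: sought_def)
  have "bottom s \<subseteq> upper_group s i"
    using bottom_indifferent(2)[OF i] sought_properties(3)[OF i]
    by (auto simp: upper_group_def priority_group_def bottom_def assigned_def indifferent_def)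
  then show ?thesis using upper_group_coalition[OF i] by blast
qed

definition low_assigned :: "'s \<Rightarrow> 'i set" where
  "low_assigned s = {i \<in> assigned \<nu> s. \<exists>j\<in>bottom s. (j, i) \<in> B s}"

text \<open>
  The bijection witnessing the comparison of \<open>\<nu>\<close> with \<open>\<mu>2\<close> at \<open>s\<close> sends low students to
  students whom the trading stage has placed in the bottom group of \<open>s\<close>.
\<close>

lemma card_low_assigned_le:
  assumes "s \<in> sought"
  shows "card (low_assigned s) \<le> card (bottom s)"
proof -
  obtain i where i: "i \<in> improvers" "\<nu> i = Some s" using assms by (auto simp: sought_def)
  note s = sought_properties(1)[OF i]
  let ?M = "{i \<in> initially_active \<mu>1. \<mu>2 i = Some s}"
  obtain f where f: "bij_betw f (assigned \<nu> s) (assigned \<mu>2 s)"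
      "\<forall>a\<in>assigned \<nu> s. (a, f a) \<in> B s"
    using enforcedD(1)[OF i] by (auto simp: set_weakly_above_def)
  have "f n \<in> ?M" if n: "n \<in> low_assigned s" for n
  proof -
    obtain j where j: "j \<in> bottom s" "(j, n) \<in> B s" and n': "n \<in> assigned \<nu> s"
      using n by (auto simp: low_assigned_def)
    then have fn: "f n \<in> assigned \<mu>2 s" "(j, f n) \<in> B s"
      using f bij_betwE between_trans[OF s] by blast+
    \<comment> \<open>Otherwise \<open>f n\<close> kept her \<open>\<mu>1\<close>-place at
      \<open>s\<close>; being no higher than the bottom class she would belong to it, and so be
      initially active.\<close>
    have "f n \<in> initially_active \<mu>1"
    proof (rule ccontr)
      assume n: "f n \<notin> initially_active \<mu>1"
      then have "f n \<in> assigned \<mu>1 s"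
        using fn(1) ttc_unchanged[OF result] by (simp add: assigned_def)
      moreover have "\<forall>k\<in>assigned \<mu>1 s. (k, f n) \<in> B s"
        using j(1) fn(2) between_trans[OF s] by (auto simp: bottom_eq[OF s])
      ultimately have "f n \<in> bottom s" by (auto simp: bottom_eq[OF s])
      then show False using n by (simp add: bottom_def)
    qed
    then show ?thesis using fn by (simp add: assigned_def)
  qed
  then have "f ` low_assigned s \<subseteq> ?M" by blast
  moreover have "inj_on f (low_assigned s)"
    using f(1) by (auto simp: bij_betw_def low_assigned_def intro: inj_on_subset)
  moreover have "finite ?M" using finite_initially_active by simp
  ultimately have "card (low_assigned s) \<le> card ?M" by (metis card_image card_mono)
  also have "card ?M = card {i \<in> initially_active \<mu>1. \<mu>1 i = Some s}"
    by (rule card_ttc_reassigned[OF result])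
  also have "{i \<in> initially_active \<mu>1. \<mu>1 i = Some s} = bottom s"
    using initially_active_subset by (auto simp: bottom_def assigned_def)
  finally show ?thesis .
qed

text \<open>The induction hypothesis over the trading cycles: departed students who received a
  sought school hold it in \<open>\<nu>\<close> too.\<close>

definition agrees :: "'i set \<Rightarrow> ('i \<rightharpoonup> 's) \<Rightarrow> bool" where
  "agrees A \<mu> \<longleftrightarrow>
     (\<forall>i\<in>initially_active \<mu>1 - A. \<forall>s\<in>sought. \<mu> i = Some s \<longrightarrow> \<nu> i = Some s)"

text \<open>
  Once the bottom group of a sought school has departed, the students who took its places
  already exhaust the places that \<open>\<nu>\<close> has for low students there.
\<close>

lemma departed_bottom_exhausted:
  assumes inv: "ttc_invariant \<mu>1 A \<mu>" and agr: "agrees A \<mu>"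
    and i: "i \<in> improvers" "\<nu> i = Some s" and gone: "bottom s \<inter> A = {}"
  shows "i \<in> initially_active \<mu>1 - A \<and> \<mu> i = Some s"
proof -
  have s: "s \<in> S" "s \<in> sought" using sought_properties[OF i] i by (auto simp: sought_def)
  let ?M = "{i \<in> initially_active \<mu>1 - A. \<mu> i = Some s}"
  have "?M \<subseteq> low_assigned s"
  proof
    fix m assume m: "m \<in> ?M"
    then have "\<nu> m = Some s" "m \<in> I"
      using agr s(2) initially_active_subset by (auto simp: agrees_def)
    moreover have "\<exists>t\<in>S. \<mu> m = Some t \<and> (\<exists>j\<in>bottom t. indifferent t m j)"
      using inv m unfolding ttc_invariant_def bottom_def by blast
    then obtain j where "j \<in> bottom s" "indifferent s m j" using m by auto
    ultimately show "m \<in> low_assigned s"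
      by (auto simp: low_assigned_def assigned_def indifferent_def)
  qed
  moreover have "finite (low_assigned s)" by (simp add: low_assigned_def)
  moreover have "card (low_assigned s) \<le> card ?M"
  proof -
    have "card ?M = card {i \<in> initially_active \<mu>1 - A. \<mu>1 i = Some s}"
      using inv by (simp add: ttc_invariant_def)
    \<comment> \<open>With the bottom class gone, the departed students who held \<open>s\<close>
      are precisely that class.\<close>
    also have "{i \<in> initially_active \<mu>1 - A. \<mu>1 i = Some s} = bottom s"
      using gone initially_active_subset by (auto simp: bottom_def assigned_def)
    finally show ?thesis using card_low_assigned_le[OF s(2)] by simp
  qed
  \<comment> \<open>The recipients of \<open>s\<close> are low and at least as many as all low
    students, so the low student \<open>i\<close> is one of them.\<close>
  ultimately have "?M = low_assigned s" by (metis card_seteq)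
  moreover have "i \<in> low_assigned s"
    using bottom_indifferent[OF i] i improvers_coalition[OF i(1)]
    by (auto simp: low_assigned_def assigned_def indifferent_def)
  ultimately show ?thesis by blast
qed

text \<open>
  In a cycle, the property of obtaining a sought school passes from a student to the one who
  is pointed at by that school: the latter belongs to the coalition, and her \<open>\<nu>\<close>-school is
  still available to her.
\<close>

lemma cycle_agrees:
  assumes inv: "ttc_invariant \<mu>1 A \<mu>" and agr: "agrees A \<mu>" and cyc: "ttc_cycle \<mu>1 A js ss"
    and final: "\<And>k. k < length js \<Longrightarrow> \<mu>2 (js ! k) = Some (ss ! k)"
  shows "agrees (A - set js) (\<mu>(js [\<mapsto>] ss))"
proof -
  let ?n = "length js"
  let ?next = "\<lambda>k. Suc k mod ?n"
  have next_less: "?next k < ?n" if "k < ?n" for k using that by (auto intro: mod_less_divisor)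
  have step: "ss ! ?next k \<in> sought \<and> \<nu> (js ! ?next k) = Some (ss ! ?next k)"
    if k: "k < ?n" and t: "ss ! k \<in> sought" for k
  proof -
    define i t where "i = js ! ?next k" and "t = ss ! ?next k"
    have A: "A \<subseteq> initially_active \<mu>1" using inv by (simp add: ttc_invariant_def)
    have i_at: "i \<in> assigned \<mu>1 (ss ! k) \<inter> A"
      using ttc_cycle_nth(3)[OF cyc k] by (simp add: i_def)
    then have "i \<in> bottom (ss ! k)" using A by (auto simp: bottom_def)
    then have iC: "i \<in> C" using bottom_coalition[OF t] by blast
    then have iI: "i \<in> I" using coalition by blast
    have point: "student_points \<mu>1 A i t" and \<mu>2: "\<mu>2 i = Some t"
      using ttc_cycle_nth(2)[OF cyc next_less[OF k]] final[OF next_less[OF k]]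
      by (simp_all add: i_def t_def)
    obtain u j where u: "\<nu> i = Some u" "u \<in> S" "u \<in> sought"
        and j: "j \<in> assigned \<mu>1 u \<inter> A" "indifferent u i j"
    proof (cases "i \<in> improvers")
      case True
      then obtain u where u: "\<nu> i = Some u" "u \<in> S" "u \<in> sought" by (rule improver_seeks)
      \<comment> \<open>Had the whole bottom class departed, \<open>i\<close> would have departed as
        well, but she is still active.\<close>
      have "bottom u \<inter> A \<noteq> {}"
        using departed_bottom_exhausted[OF inv agr True u(1)] i_at by blast
      then obtain j where "j \<in> bottom u" "j \<in> A" by blast
      then show thesis
        using that u bottom_indifferent(2)[OF True u(1)] by (auto simp: bottom_def)
    next
      case False
      \<comment> \<open>A member who is no improver finds \<open>\<nu>\<close> at least as good as
        \<open>\<mu>1\<close> but not better, so both give her the same school.\<close>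
      have "(\<nu> i, \<mu>1 i) \<in> (P i)\<^sup>="
        using preference_chain[OF iI _ ttc_weakly_improves[OF result]] weakly_preferred[OF iC]
          ttc_weakly_improves[OF result, of i] by auto
      then have "\<nu> i = \<mu>1 i" using False iC by (auto simp: improvers_def)
      then have "\<nu> i = Some (ss ! k)" using i_at by (simp add: assigned_def)
      moreover have "ss ! k \<in> S" using ttc_cycle_nth(1)[OF cyc k] .
      ultimately show thesis
        using that[of "ss ! k" i] t i_at iI between_refl by (simp add: indifferent_def)
    qed
    \<comment> \<open>\<open>u\<close> is on her menu and \<open>t\<close> is her best choice from
      it, while \<open>\<nu>\<close> is weakly better for her than \<open>\<mu>2\<close>; the two
      comparisons force equality.\<close>
    have "(Some t, Some u) \<in> (P i)\<^sup>=" by (rule student_points_weakly_prefers[OF point u(2) j])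
    moreover have "(Some u, Some t) \<in> (P i)\<^sup>=" using weakly_preferred[OF iC] u \<mu>2 by simp
    ultimately have "u = t"
      using preference_trans[OF iI] preference_irrefl[OF iI] by auto
    then show ?thesis using u by (simp add: i_def t_def)
  qed
  have sought_all: "ss ! k \<in> sought \<and> \<nu> (js ! k) = Some (ss ! k)"
    if "k < ?n" "ss ! k \<in> sought" for k
  proof -
    let ?Q = "\<lambda>k. ss ! k \<in> sought \<and> \<nu> (js ! k) = Some (ss ! k)"
    \<comment> \<open>\<open>step\<close> yields the full property only at the successor, so it is
      carried once around the cycle back to \<open>k\<close>.\<close>
    have "?Q (?next k)" using step that by blast
    then show "?Q k"
      using cyclic_invariant[of ?n ?Q "?next k" k] step next_less that(1) by blast
  qed
  show ?thesis
    unfolding agrees_def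
  proof (intro ballI impI)
    fix i s assume i: "i \<in> initially_active \<mu>1 - (A - set js)" and s: "s \<in> sought"
      and val: "(\<mu>(js [\<mapsto>] ss)) i = Some s"
    show "\<nu> i = Some s"
    proof (cases "i \<in> set js")
      case True
      then obtain k where k: "k < ?n" "i = js ! k" by (auto simp: in_set_conv_nth)
      then have "ss ! k = s" using ttc_cycle_nth(4)[OF cyc k(1)] val by simp
      then show ?thesis using sought_all[OF k(1)] s k by simp
    next
      case False
      then have "\<mu> i = Some s" using val by (simp add: map_upds_apply_nontin)
      then show ?thesis using agr i s False by (simp add: agrees_def)
    qed
  qed
qed

text \<open>At the end of the run no bottom class is active, so
  \<open>departed_bottom_exhausted\<close> gives every improver the same school in
  \<open>\<mu>2\<close> as in \<open>\<nu>\<close>.\<close>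

lemma no_strict_improvement:
  assumes "i \<in> C"
  shows "(\<nu> i, \<mu>2 i) \<notin> P i"
proof
  assume strict: "(\<nu> i, \<mu>2 i) \<in> P i"
  have iI: "i \<in> I" using assms coalition by blast
  have "i \<in> improvers"
    using preference_chain[OF iI strict ttc_weakly_improves[OF result]] assms
    by (simp add: improvers_def)
  then obtain s where s: "\<nu> i = Some s" using improver_seeks by blast
  have "ttc_invariant \<mu>1 {} \<mu>2 \<and> agrees {} \<mu>2"
    using result
  proof (induction rule: ttc_result_induct)
    case start
    then show ?case by (simp add: agrees_def)
  next
    case (cycle A \<mu> js ss)
    then show ?case by (intro cycle_agrees)
  qed
  then have "\<mu>2 i = Some s"
    using departed_bottom_exhausted[OF _ _ \<open>i \<in> improvers\<close> s] by blast
  then show False using strict s preference_irrefl[OF iI] by simp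
qed

end

section \<open>Membership in the unified core\<close>

context school_choice
begin

lemma not_within_blocked:
  assumes "stable \<mu>1" "ttc_result \<mu>1 \<mu>2" "C \<subseteq> I"
  shows "\<not> within_blocks C \<mu>2"
proof
  assume "within_blocks C \<mu>2"
  then obtain \<nu> where enf: "within_enforces C \<nu> \<mu>2"
    and weak: "\<forall>i\<in>C. (\<nu> i, \<mu>2 i) \<in> (P i)\<^sup>=" and strict: "\<exists>i\<in>C. (\<nu> i, \<mu>2 i) \<in> P i"
    unfolding within_blocks_def coalition_prefers_def by blast
  interpret within_deviation I S q P B W \<mu>1 \<mu>2 \<nu> C
    by unfold_locales (use assms enf weak in blast)+
  show False using no_strict_improvement strict by blast
qed

lemma da_ttc_result_unified_core:
  assumes "da_ttc_result \<mu>2"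
  shows "\<mu>2 \<in> unified_core"
proof -
  obtain \<mu>1 where da: "da_result \<mu>1" and ttc: "ttc_result \<mu>1 \<mu>2"
    using assms by (auto simp: da_ttc_result_def)
  have stable: "stable \<mu>1" using da by (rule da_result_stable)
  then have "is_match \<mu>2" using ttc_result_match ttc by (auto simp: stable_def)
  then show ?thesis
    using not_between_blocked not_within_blocked stable ttc unfolding unified_core_def by blast
qed

text \<open>Ensures that the statement about all outcomes of the algorithm is not vacuous.\<close>

lemma da_ttc_result_exists: "\<exists>\<mu>2. da_ttc_result \<mu>2"
  using da_result_exists ttc_result_exists unfolding da_ttc_result_def by blast

end

theorem theorem1:
  fixes I :: "'i set"
    and S :: "'s set"
    and q :: "'s \<Rightarrow> nat"
    and P :: "'i \<Rightarrow> 's option rel"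
    and B :: "'s \<Rightarrow> 'i rel"
    and W :: "'s \<Rightarrow> 'i rel"
  assumes "school_choice I S q P B W"
  shows "(\<exists>\<mu>2. school_choice.da_ttc_result I S q P B W \<mu>2) \<and>
         (\<forall>\<mu>2. school_choice.da_ttc_result I S q P B W \<mu>2 \<longrightarrow>
                 \<mu>2 \<in> school_choice.unified_core I S q P B W)"
proof -
  interpret school_choice I S q P B W by (rule assms)
  show ?thesis using da_ttc_result_exists da_ttc_result_unified_core by blast
qed

end
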